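(* Let $I=(\mathcal{E},D,c,f)$ be a CMP instance whose objective $f$ is of type sum, product, or bottleneck, and let $E=\{e_1,\dots,e_k\}\subseteq\mathcal{E}$ be an arbitrary subset. Then: (a) $\max_{l=1}^k l'_I(e_l)\le l'_I(E)\le\sum_{l=1}^k l'_I(e_l)$. (b) If $f$ is of type bottleneck, then $l'_I(E)=\sum_{l=1}^k l'_I(e_l)$.
   Context: A combinatorial minimization problem (CMP) instance is $I=(\mathcal{E},D,c,f)$ where $\mathcal{E}$ is a finite ground set, $D\subseteq 2^{\mathcal{E}}\setminus\{\emptyset\}$ is a nonempty set of feasible solutions, $c:\mathcal{E}\to\mathbb{R}$ is a cost function, and $f:D\to\mathbb{R}$ is of one of three types: sum, $f(S)=\sum_{a\in S}c(a)$; product, $f(S)=\prod_{a\in S}c(a)$, where for this type all costs are positive; bottleneck, $f(S)=\max_{a\in S}c(a)$. $f(I)$ denotes the optimal (minimum) value of $f$ over $D$. For $E=\{e_1,\dots,e_k\}\subseteq\mathcal{E}$ and $\vec\alpha\in\mathbb{R}^k$, $I_{-\vec\alpha,E}$ is the instance with costs $c(e_l)-\alpha_l$ on $e_l$, other costs unchanged, and objective of the same type computed with these costs; $f_{-\vec\alpha,E}(I_{-\vec\alpha,E})$ is its optimal value. Let $\mathrm{maxdec}(e)=\infty$ if $f$ is of type sum or bottleneck and $\mathrm{maxdec}(e)=c(e)$ if of type product. The (new) regular set lower tolerance is $l'_I(E)=\sup\{\alpha\in\mathbb{R}\mid \exists\,\vec\alpha=(\alpha_1,\dots,\alpha_k)$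 with $0\le\alpha_l<\mathrm{maxdec}(e_l)$ for all $l$, $\sum_{l=1}^k\alpha_l=\alpha$, and $f_{-\vec\alpha,E}(I_{-\vec\alpha,E})=f(I)\}$, with values in $\mathbb{R}\cup\{\infty\}$; for a single element $e$, $l'_I(e)=l'_I(\{e\})$. *)

theory Defs
  imports Complex_Main "HOL-Library.Extended_Real"
begin

datatype objective_type = Sum_type | Product_type | Bottleneck_type

text \<open>
  The objective is recorded by its type rather than as a bare function on the feasible sets: the
  objective of an instance with changed costs is the one of the same type, and distinct types can
  induce the same function (for example if all feasible sets are singletons).
\<close>

record 'a cmp =
  ground :: "'a set"
  feasible :: "'a set set"
  cost :: "'a \<Rightarrow> real"
  obj_type :: objective_type

definition cmp_instance :: "'a cmp \<Rightarrow> bool" where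
  "cmp_instance I \<longleftrightarrow>
     finite (ground I) \<and>
     feasible I \<subseteq> Pow (ground I) - {{}} \<and>
     feasible I \<noteq> {} \<and>
     (obj_type I = Product_type \<longrightarrow> (\<forall>a\<in>ground I. 0 < cost I a))"

definition objective :: "'a cmp \<Rightarrow> 'a set \<Rightarrow> real" where
  "objective I S =
     (case obj_type I of
        Sum_type \<Rightarrow> (\<Sum>a\<in>S. cost I a)
      | Product_type \<Rightarrow> (\<Prod>a\<in>S. cost I a)
      | Bottleneck_type \<Rightarrow> Max (cost I ` S))"

definition opt_value :: "'a cmp \<Rightarrow> real" where
  "opt_value I = Min (objective I ` feasible I)"

text \<open>
  A vector of decrements for a set \<open>E\<close> is a function on the elements, of which only the values
  on \<open>E\<close> matter.
\<close>

definition decrease :: "('a \<Rightarrow> real) \<Rightarrow> 'a set \<Rightarrow> 'a cmp \<Rightarrow> 'a cmp" where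
  "decrease \<alpha> E I = I\<lparr>cost := (\<lambda>a. if a \<in> E then cost I a - \<alpha> a else cost I a)\<rparr>"

definition maxdec :: "'a cmp \<Rightarrow> 'a \<Rightarrow> ereal" where
  "maxdec I e = (if obj_type I = Product_type then ereal (cost I e) else \<infinity>)"

definition set_lower_tol :: "'a cmp \<Rightarrow> 'a set \<Rightarrow> ereal" where
  "set_lower_tol I E =
     Sup (ereal ` {x. \<exists>\<alpha>. (\<forall>e\<in>E. 0 \<le> \<alpha> e \<and> ereal (\<alpha> e) < maxdec I e) \<and>
                          (\<Sum>e\<in>E. \<alpha> e) = x \<and>
                          opt_value (decrease \<alpha> E I) = opt_value I})"

definition lower_tol :: "'a cmp \<Rightarrow> 'a \<Rightarrow> ereal" where
  "lower_tol I e = set_lower_tol I {e}"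

end

theory Submission
  imports Defs
begin

text \<open>
  The optimal value is monotone in the costs, so restricting or shrinking an admissible vector of
  decrements keeps it admissible; this gives both bounds. For a bottleneck objective with optimal
  value \<open>v\<close>, an element of infinite tolerance makes both sides infinite. An element \<open>e\<close> of finite
  tolerance lies in a feasible set all of whose other elements cost less than \<open>v\<close>, so it can be
  lowered exactly to \<open>v\<close>. Lowering all elements of \<open>E\<close> to \<open>v\<close> at once leaves in each feasible set
  an element of cost at least \<open>v\<close>, and therefore the tolerances add up.
\<close>

definition admissible :: "'a cmp \<Rightarrow> 'a set \<Rightarrow> ('a \<Rightarrow> real) \<Rightarrow> bool" where
  "admissible I E \<alpha> \<longleftrightarrow> (\<forall>e\<in>E. 0 \<le> \<alpha> e \<and> ereal (\<alpha> e) < maxdec I e) \<and>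
     opt_value (decrease \<alpha> E I) = opt_value I"

text \<open>Indexing the supremum by vectors instead of by their sums lets each bound be proved one
  admissible vector at a time.\<close>

lemma set_lower_tol_eq:
  "set_lower_tol I E = (SUP \<alpha>\<in>Collect (admissible I E). ereal (\<Sum>e\<in>E. \<alpha> e))"
  unfolding set_lower_tol_def admissible_def by (rule arg_cong[where f = Sup]) auto

lemma sum_le_set_lower_tol:
  "admissible I E \<alpha> \<Longrightarrow> ereal (\<Sum>e\<in>E. \<alpha> e) \<le> set_lower_tol I E"
  unfolding set_lower_tol_eq by (rule SUP_upper) simp

lemma set_lower_tol_le:
  "(\<And>\<alpha>. admissible I E \<alpha> \<Longrightarrow> ereal (\<Sum>e\<in>E. \<alpha> e) \<le> x) \<Longrightarrow> set_lower_tol I E \<le> x"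
  unfolding set_lower_tol_eq by (rule SUP_least) simp

lemma decrease_simps [simp]:
  "ground (decrease \<alpha> E I) = ground I"
  "feasible (decrease \<alpha> E I) = feasible I"
  "obj_type (decrease \<alpha> E I) = obj_type I"
  "cost (decrease \<alpha> E I) a = (if a \<in> E then cost I a - \<alpha> a else cost I a)"
  by (simp_all add: decrease_def)

lemma
  assumes "cmp_instance I"
  shows finite_feasible: "finite (feasible I)"
    and feasible_nonempty: "feasible I \<noteq> {}"
    and feasible_subset: "S \<in> feasible I \<Longrightarrow> S \<subseteq> ground I"
    and feasible_finite: "S \<in> feasible I \<Longrightarrow> finite S"
    and feasible_member_nonempty: "S \<in> feasible I \<Longrightarrow> S \<noteq> {}"
proof -
  have *: "finite (ground I)" "feasible I \<subseteq> Pow (ground I)"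
    using assms by (auto simp: cmp_instance_def)
  show "finite (feasible I)"
    using * by (meson finite_Pow_iff finite_subset)
  show "S \<in> feasible I \<Longrightarrow> finite S"
    using * by (meson PowD finite_subset subsetD)
qed (use assms in \<open>auto simp: cmp_instance_def\<close>)

text \<open>Products are monotone only in nonnegative factors, hence the last assumption; the other
  two types compare termwise without it.\<close>

lemma objective_mono:
  assumes "obj_type J = obj_type K" "finite S" "S \<noteq> {}"
    and "\<And>a. a \<in> S \<Longrightarrow> cost J a \<le> cost K a"
    and "\<And>a. a \<in> S \<Longrightarrow> obj_type K = Product_type \<Longrightarrow> 0 \<le> cost J a"
  shows "objective J S \<le> objective K S"
proof (cases "obj_type K")
  case Bottleneck_type
  have "cost J a \<le> Max (cost K ` S)" if "a \<in> S" for a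
    using assms that by (meson Max_ge finite_imageI image_eqI order_trans)
  then show ?thesis
    using assms Bottleneck_type by (simp add: objective_def)
qed (use assms in \<open>auto simp: objective_def intro!: sum_mono prod_mono\<close>)

lemma opt_value_le_iff:
  assumes "cmp_instance I" "feasible J = feasible I"
  shows "opt_value J \<le> x \<longleftrightarrow> (\<exists>S\<in>feasible I. objective J S \<le> x)"
  using finite_feasible[OF assms(1)] feasible_nonempty[OF assms(1)] assms(2)
  by (simp add: opt_value_def Min_le_iff)

lemma le_opt_value_iff:
  assumes "cmp_instance I" "feasible J = feasible I"
  shows "x \<le> opt_value J \<longleftrightarrow> (\<forall>S\<in>feasible I. x \<le> objective J S)"
  using finite_feasible[OF assms(1)] feasible_nonempty[OF assms(1)] assms(2)
  by (simp add: opt_value_def Min_ge_iff)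

lemma opt_value_mono:
  assumes "cmp_instance I" "feasible J = feasible I" "feasible K = feasible I"
    and "obj_type J = obj_type K"
    and "\<And>a. a \<in> ground I \<Longrightarrow> cost J a \<le> cost K a"
    and "\<And>a. a \<in> ground I \<Longrightarrow> obj_type K = Product_type \<Longrightarrow> 0 \<le> cost J a"
  shows "opt_value J \<le> opt_value K"
  unfolding le_opt_value_iff[OF assms(1,3)]
proof
  fix S assume S: "S \<in> feasible I"
  have "objective J S \<le> objective K S"
    using assms S feasible_subset[OF assms(1) S]
    by (intro objective_mono feasible_finite[of I] feasible_member_nonempty[of I]) auto
  then show "opt_value J \<le> objective K S"
    using opt_value_le_iff[OF assms(1,2)] S by blast
qed

text \<open>The optimal value for \<open>F\<close> is squeezed between the one for \<open>E\<close>
  and the original one, and these two agree by admissibility.\<close>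

lemma admissible_subset:
  assumes I: "cmp_instance I" and adm: "admissible I E \<alpha>" and "F \<subseteq> E"
  shows "admissible I F \<alpha>"
proof -
  have nonneg: "0 \<le> \<alpha> e" and lt: "ereal (\<alpha> e) < maxdec I e" if "e \<in> E" for e
    using adm that by (auto simp: admissible_def)
  have pos: "0 < cost I a" if "a \<in> ground I" "obj_type I = Product_type" for a
    using I that by (auto simp: cmp_instance_def)
  \<comment> \<open>For products, this bound keeps the lowered costs nonnegative, as monotonicity
    demands.\<close>
  have less: "\<alpha> e < cost I e" if "e \<in> E" "obj_type I = Product_type" for e
    using lt[OF that(1)] that(2) by (simp add: maxdec_def)
  have "opt_value (decrease \<alpha> E I) \<le> opt_value (decrease \<alpha> F I)"
    using \<open>F \<subseteq> E\<close> nonneg less pos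
    by (intro opt_value_mono[OF I]) (auto simp: less_imp_le)
  moreover have "opt_value (decrease \<alpha> F I) \<le> opt_value I"
    using \<open>F \<subseteq> E\<close> nonneg less pos
    by (intro opt_value_mono[OF I]) (auto simp: less_imp_le subset_eq)
  ultimately show ?thesis
    using adm \<open>F \<subseteq> E\<close> by (auto simp: admissible_def)
qed

text \<open>A decrement of one element, extended by zero to \<open>E\<close>, yields the same
  instance and the same sum.\<close>

lemma lower_tol_le_set_lower_tol:
  assumes I: "cmp_instance I" and E: "E \<subseteq> ground I" and e: "e \<in> E"
  shows "lower_tol I e \<le> set_lower_tol I E"
  unfolding lower_tol_def
proof (rule set_lower_tol_le)
  fix \<alpha> assume adm: "admissible I {e} \<alpha>"
  define \<beta> where "\<beta> = (\<lambda>a. if a = e then \<alpha> a else 0)"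
  have "decrease \<beta> E I = decrease \<alpha> {e} I"
    using e by (auto simp: decrease_def \<beta>_def fun_eq_iff intro!: cmp.fold_congs)
  \<comment> \<open>The zero entries must be permitted too; for products this is positivity of the
    costs on the ground set.\<close>
  moreover have "0 < maxdec I a" if "a \<in> E" for a
    using I E that by (auto simp: maxdec_def cmp_instance_def)
  ultimately have "admissible I E \<beta>"
    using adm by (auto simp: admissible_def \<beta>_def zero_ereal_def[symmetric])
  then have "ereal (\<Sum>a\<in>E. \<beta> a) \<le> set_lower_tol I E"
    by (rule sum_le_set_lower_tol)
  moreover have "finite E"
    using I E by (auto simp: cmp_instance_def dest: finite_subset)
  ultimately show "ereal (\<Sum>a\<in>{e}. \<alpha> a) \<le> set_lower_tol I E"
    using e by (simp add: \<beta>_def)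
qed

text \<open>Each coordinate of a vector admissible for \<open>E\<close> is admissible for its own
  singleton.\<close>

lemma set_lower_tol_le_sum:
  assumes I: "cmp_instance I"
  shows "set_lower_tol I E \<le> (\<Sum>e\<in>E. lower_tol I e)"
proof (rule set_lower_tol_le)
  fix \<alpha> assume adm: "admissible I E \<alpha>"
  have "ereal (\<alpha> e) \<le> lower_tol I e" if "e \<in> E" for e
    using sum_le_set_lower_tol[OF admissible_subset[OF I adm, of "{e}"]] that
    by (simp add: lower_tol_def)
  then show "ereal (\<Sum>e\<in>E. \<alpha> e) \<le> (\<Sum>e\<in>E. lower_tol I e)"
    unfolding sum_ereal[symmetric] by (rule sum_mono)
qed

lemma le_bottleneck_objective_iff:
  assumes "cmp_instance I" "S \<in> feasible I" "obj_type J = Bottleneck_type"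
  shows "x \<le> objective J S \<longleftrightarrow> (\<exists>a\<in>S. x \<le> cost J a)"
  using feasible_finite[OF assms(1,2)] feasible_member_nonempty[OF assms(1,2)] assms(3)
  by (simp add: objective_def Max_ge_iff)

lemma le_bottleneck_opt_value_iff:
  assumes "cmp_instance I" "feasible J = feasible I" "obj_type J = Bottleneck_type"
  shows "x \<le> opt_value J \<longleftrightarrow> (\<forall>S\<in>feasible I. \<exists>a\<in>S. x \<le> cost J a)"
  using assms by (simp add: le_opt_value_iff le_bottleneck_objective_iff)

text \<open>Finiteness yields a feasible set \<open>S\<close> in which \<open>e\<close> alone costs
  at least the optimal value, so \<open>e\<close> cannot be lowered past that value.\<close>

lemma bottleneck_finite_lower_tol:
  assumes I: "cmp_instance I" and bn: "obj_type I = Bottleneck_type"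
    and fin: "lower_tol I e \<noteq> \<infinity>"
  shows "opt_value I \<le> cost I e" "lower_tol I e \<le> ereal (cost I e - opt_value I)"
proof -
  let ?v = "opt_value I"
  \<comment> \<open>If every nonnegative decrement were admissible, the tolerance would exceed all
    reals.\<close>
  obtain t where t: "0 \<le> t" "\<not> admissible I {e} (\<lambda>_. t)"
  proof (rule ccontr)
    assume "\<not> thesis"
    then have "admissible I {e} (\<lambda>_. t)" if "0 \<le> t" for t
      using that \<open>\<And>t. \<lbrakk>0 \<le> t; \<not> admissible I {e} (\<lambda>_. t)\<rbrakk> \<Longrightarrow> thesis\<close> by blast
    then have *: "ereal t \<le> lower_tol I e" if "0 \<le> t" for t
      using sum_le_set_lower_tol[of I "{e}" "\<lambda>_. t"] that by (simp add: lower_tol_def)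
    have "ereal t \<le> lower_tol I e" for t
      using *[of "max 0 t"] by (meson ereal_less_eq(3) max.cobounded1 max.cobounded2 order_trans)
    then have "lower_tol I e = \<infinity>"
      by (rule ereal_top)
    with fin show False by simp
  qed
  \<comment> \<open>As \<open>maxdec\<close> is infinite here, only a changed optimal value can
    violate admissibility.\<close>
  have "opt_value (decrease (\<lambda>_. t) {e} I) \<noteq> ?v"
    using t bn by (simp add: admissible_def maxdec_def)
  moreover have "opt_value (decrease (\<lambda>_. t) {e} I) \<le> ?v"
    using t bn by (intro opt_value_mono[OF I]) auto
  ultimately have "\<not> ?v \<le> opt_value (decrease (\<lambda>_. t) {e} I)"
    by simp
  then obtain S where S: "S \<in> feasible I"
    "\<And>a. a \<in> S \<Longrightarrow> cost (decrease (\<lambda>_. t) {e} I) a < ?v"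
    by (subst (asm) le_bottleneck_opt_value_iff[OF I]) (auto simp: bn not_le)
  have others: "cost I a < ?v" if "a \<in> S" "a \<noteq> e" for a
    using S(2)[OF that(1)] that(2) by simp
  \<comment> \<open>Before the decrement \<open>S\<close> does reach the optimal value, and only
    \<open>e\<close> can be responsible.\<close>
  obtain a where "a \<in> S" "?v \<le> cost I a"
    using le_bottleneck_opt_value_iff[OF I refl bn, of ?v] S(1) by auto
  then show "?v \<le> cost I e"
    using others by fastforce
  show "lower_tol I e \<le> ereal (cost I e - ?v)"
    unfolding lower_tol_def
  proof (rule set_lower_tol_le)
    fix \<alpha> assume "admissible I {e} \<alpha>"
    then have "?v \<le> opt_value (decrease \<alpha> {e} I)"
      by (simp add: admissible_def)
    then obtain a where a: "a \<in> S" "?v \<le> cost (decrease \<alpha> {e} I) a"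
      using le_bottleneck_opt_value_iff[OF I, of "decrease \<alpha> {e} I" ?v] S(1) bn by auto
    then have "a = e"
      using others by (fastforce split: if_splits)
    with a show "ereal (\<Sum>a\<in>{e}. \<alpha> a) \<le> ereal (cost I e - ?v)"
      by simp
  qed
qed

lemma bottleneck_sum_le_set_lower_tol:
  assumes I: "cmp_instance I" and E: "E \<subseteq> ground I" and bn: "obj_type I = Bottleneck_type"
  shows "(\<Sum>e\<in>E. lower_tol I e) \<le> set_lower_tol I E"
proof (cases "\<exists>e\<in>E. lower_tol I e = \<infinity>")
  case True
  then have "set_lower_tol I E = \<infinity>"
    using lower_tol_le_set_lower_tol[OF I E] by fastforce
  then show ?thesis by simp
next
  case False
  let ?v = "opt_value I"
  \<comment> \<open>This vector brings every element of \<open>E\<close> exactly to the optimal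
    value, and its entries bound the single tolerances from above.\<close>
  define \<alpha> where "\<alpha> = (\<lambda>e. cost I e - ?v)"
  have nonneg: "0 \<le> \<alpha> e" and le: "lower_tol I e \<le> ereal (\<alpha> e)" if "e \<in> E" for e
    using bottleneck_finite_lower_tol[OF I bn, of e] False that by (auto simp: \<alpha>_def)
  have "?v \<le> opt_value (decrease \<alpha> E I)"
  proof (subst le_bottleneck_opt_value_iff[OF I]; (simp add: bn; fail)?)
    show "\<forall>S\<in>feasible I. \<exists>a\<in>S. ?v \<le> cost (decrease \<alpha> E I) a"
    proof
      fix S assume "S \<in> feasible I"
      then obtain a where "a \<in> S" "?v \<le> cost I a"
        using le_bottleneck_opt_value_iff[OF I refl bn, of ?v] by auto
      \<comment> \<open>The same \<open>a\<close> still serves: its cost becomes \<open>?v\<close>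
        if it lies in \<open>E\<close> and is unchanged otherwise.\<close>
      then show "\<exists>a\<in>S. ?v \<le> cost (decrease \<alpha> E I) a"
        by (intro bexI[of _ a]) (auto simp: \<alpha>_def)
    qed
  qed
  moreover have "opt_value (decrease \<alpha> E I) \<le> ?v"
    using nonneg bn by (intro opt_value_mono[OF I]) auto
  ultimately have "admissible I E \<alpha>"
    using nonneg bn by (simp add: admissible_def maxdec_def)
  have "(\<Sum>e\<in>E. lower_tol I e) \<le> (\<Sum>e\<in>E. ereal (\<alpha> e))"
    by (rule sum_mono) (rule le)
  also have "\<dots> \<le> set_lower_tol I E"
    using sum_le_set_lower_tol[OF \<open>admissible I E \<alpha>\<close>] by simp
  finally show ?thesis .
qed

text \<open>The first bound is guarded because \<open>Max\<close> of the empty set is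
  unspecified.\<close>

theorem theorem5:
  fixes I :: "'a cmp" and E :: "'a set"
  assumes "cmp_instance I" and "E \<subseteq> ground I"
  shows "(E \<noteq> {} \<longrightarrow> Max (lower_tol I ` E) \<le> set_lower_tol I E) \<and>
         set_lower_tol I E \<le> (\<Sum>e\<in>E. lower_tol I e) \<and>
         (obj_type I = Bottleneck_type \<longrightarrow> set_lower_tol I E = (\<Sum>e\<in>E. lower_tol I e))"
proof (intro conjI impI)
  have "finite E"
    using assms by (auto simp: cmp_instance_def dest: finite_subset)
  then show "Max (lower_tol I ` E) \<le> set_lower_tol I E" if "E \<noteq> {}"
    using that lower_tol_le_set_lower_tol[OF assms] by simp
  show "set_lower_tol I E \<le> (\<Sum>e\<in>E. lower_tol I e)"
    by (rule set_lower_tol_le_sum[OF assms(1)])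
  then show "set_lower_tol I E = (\<Sum>e\<in>E. lower_tol I e)" if "obj_type I = Bottleneck_type"
    using bottleneck_sum_le_set_lower_tol[OF assms that] by (rule antisym)
qed

end
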